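(* Let $n\ge2$, $\boldsymbol{\mu}\in\mathbb{R}^n$, let $\boldsymbol{\Sigma}$ be a positive definite $n\times n$ covariance matrix, let $\theta\ge 0$ and $i\in\mathbb{N}_0$. Let $S\sim\mathcal{SLN}(\boldsymbol{\mu},\boldsymbol{\Sigma})$ and $\mathscr{L}_i(\theta)=\mathbb{E}[S^i e^{-\theta S}]$. Let $\boldsymbol{x}^*$ be a minimiser over $\boldsymbol{x}\in\mathbb{R}^n$ of $$h_{\theta,i}(\boldsymbol{x})=-i\ln(\boldsymbol{1}^\top \mathbf{e}^{\boldsymbol{\mu}+\boldsymbol{x}})+\theta\,\boldsymbol{1}^\top\mathbf{e}^{\boldsymbol{\mu}+\boldsymbol{x}}+\tfrac12\boldsymbol{x}^\top\boldsymbol{\Sigma}^{-1}\boldsymbol{x},$$ and let $$\boldsymbol{H}=i\,\frac{\mathbf{e}^{\boldsymbol{\mu}+\boldsymbol{x}^*}(\mathbf{e}^{\boldsymbol{\mu}+\boldsymbol{x}^*})^\top}{(\boldsymbol{1}^\top\mathbf{e}^{\boldsymbol{\mu}+\boldsymbol{x}^*})^2}+\boldsymbol{\Sigma}^{-1}-\mathrm{diag}(\boldsymbol{\Sigma}^{-1}\boldsymbol{x}^* )$$ be the Hessian of $h_{\theta,i}$ at $\boldsymbol{x}^*$, assumed nonsingular. Define $$\widetilde{\mathscr{L}}_i(\theta)=\frac{\exp\{-h_{\theta,i}(\boldsymbol{x}^* )\}}{\sqrt{|\boldsymbol{\Sigma}\boldsymbol{H}|}} .$$ Then $\mathscr{L}_i(\theta)=\widetilde{\mathscr{L}}_i(\theta)\,I_i(\theta)$,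 where $$I_i(\theta)=\sqrt{|\boldsymbol{\Sigma}\boldsymbol{H}|}\;v(\boldsymbol{0})^{-1}\;\mathbb{E}\big[v(\boldsymbol{\Sigma}^{1/2}Z)\big],$$ with $Z\sim\mathcal{N}(\boldsymbol{0},\boldsymbol{I})$ a standard normal vector in $\mathbb{R}^n$ and $$v(\boldsymbol{z})=\exp\big\{i\ln(\boldsymbol{1}^\top\mathbf{e}^{\boldsymbol{\mu}+\boldsymbol{x}^*+\boldsymbol{z}})-\theta\,\boldsymbol{1}^\top\mathbf{e}^{\boldsymbol{\mu}+\boldsymbol{x}^*+\boldsymbol{z}}-(\boldsymbol{x}^* )^\top\boldsymbol{\Sigma}^{-1}\boldsymbol{z}\big\}.$$
   Context: $\mathcal{SLN}(\boldsymbol{\mu},\boldsymbol{\Sigma})$ denotes the distribution of $S=e^{X_1}+\dots+e^{X_n}$ where $(X_1,\dots,X_n)$ is multivariate normal with mean vector $\boldsymbol{\mu}$ and covariance matrix $\boldsymbol{\Sigma}$. For $\boldsymbol{x}\in\mathbb{R}^n$, $\mathbf{e}^{\boldsymbol{x}}=(e^{x_1},\dots,e^{x_n})^\top$ componentwise; $\boldsymbol{1}$ is the all-ones vector; $|\cdot|$ of a matrix is its determinant; $\mathrm{diag}(\boldsymbol{w})$ of a vector is the diagonal matrix with diagonal $\boldsymbol{w}$; $\boldsymbol{\Sigma}^{1/2}$ is the symmetric positive definite square root. *)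

theory Defs
  imports "HOL-Probability.Probability"
begin

definition positive_definite :: "real ^ 'n ^ 'n \<Rightarrow> bool" where
  "positive_definite A \<longleftrightarrow> transpose A = A \<and> (\<forall>x. x \<noteq> 0 \<longrightarrow> x \<bullet> (A *v x) > 0)"

definition matrix_sqrt :: "real ^ 'n ^ 'n \<Rightarrow> real ^ 'n ^ 'n" where
  "matrix_sqrt A = (THE R. positive_definite R \<and> R ** R = A)"

definition diag :: "real ^ 'n \<Rightarrow> real ^ 'n ^ 'n" where
  "diag w = (\<chi> a b. if a = b then w $ a else 0)"

definition exp_vec :: "real ^ 'n \<Rightarrow> real ^ 'n" where
  "exp_vec x = (\<chi> k. exp (x $ k))"

definition outer :: "real ^ 'n \<Rightarrow> real ^ 'n \<Rightarrow> real ^ 'n ^ 'n" where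
  "outer x y = (\<chi> a b. x $ a * y $ b)"

(* The density form is only meaningful for positive definite covariance matrices,
   i.e. for nondegenerate normal distributions. *)
definition mv_normal :: "real ^ 'n \<Rightarrow> real ^ 'n ^ 'n \<Rightarrow> (real ^ 'n) measure" where
  "mv_normal \<mu> \<Sigma> = density lborel (\<lambda>x. ennreal
     (exp (- ((x - \<mu>) \<bullet> (matrix_inv \<Sigma> *v (x - \<mu>))) / 2) / sqrt ((2 * pi) ^ CARD('n) * det \<Sigma>)))"

(* In the type real ^ 'n, the constant 1 is the all-ones vector. *)
definition SLN :: "real ^ 'n \<Rightarrow> real ^ 'n ^ 'n \<Rightarrow> real measure" where
  "SLN \<mu> \<Sigma> = distr (mv_normal \<mu> \<Sigma>) borel (\<lambda>x. 1 \<bullet> exp_vec x)"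

definition h_fun :: "real ^ 'n \<Rightarrow> real ^ 'n ^ 'n \<Rightarrow> real \<Rightarrow> nat \<Rightarrow> real ^ 'n \<Rightarrow> real" where
  "h_fun \<mu> \<Sigma> \<theta> i x =
     - real i * ln (1 \<bullet> exp_vec (\<mu> + x)) + \<theta> * (1 \<bullet> exp_vec (\<mu> + x))
     + (x \<bullet> (matrix_inv \<Sigma> *v x)) / 2"

(* The Hessian of h_fun at a critical point xs: the stationarity equation has been used
   to replace the diagonal part of the second derivative by - diag (matrix_inv \<Sigma> *v xs). *)
definition H_mat :: "real ^ 'n \<Rightarrow> real ^ 'n ^ 'n \<Rightarrow> nat \<Rightarrow> real ^ 'n \<Rightarrow> real ^ 'n ^ 'n" where
  "H_mat \<mu> \<Sigma> i xs =
     (real i / (1 \<bullet> exp_vec (\<mu> + xs))\<^sup>2) *\<^sub>R outer (exp_vec (\<mu> + xs)) (exp_vec (\<mu> + xs))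
     + matrix_inv \<Sigma> - diag (matrix_inv \<Sigma> *v xs)"

definition L_tilde :: "real ^ 'n \<Rightarrow> real ^ 'n ^ 'n \<Rightarrow> real \<Rightarrow> nat \<Rightarrow> real ^ 'n \<Rightarrow> real" where
  "L_tilde \<mu> \<Sigma> \<theta> i xs = exp (- h_fun \<mu> \<Sigma> \<theta> i xs) / sqrt (det (\<Sigma> ** H_mat \<mu> \<Sigma> i xs))"

definition v_fun ::
  "real ^ 'n \<Rightarrow> real ^ 'n ^ 'n \<Rightarrow> real \<Rightarrow> nat \<Rightarrow> real ^ 'n \<Rightarrow> real ^ 'n \<Rightarrow> real" where
  "v_fun \<mu> \<Sigma> \<theta> i xs z =
     exp (real i * ln (1 \<bullet> exp_vec (\<mu> + xs + z)) - \<theta> * (1 \<bullet> exp_vec (\<mu> + xs + z))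
          - xs \<bullet> (matrix_inv \<Sigma> *v z))"

end

theory Submission
  imports Defs
begin

text \<open>Substituting \<open>x = \<mu> + x\<^sup>* + z\<close> in the integral of \<open>S\<^sup>i e\<^sup>-\<^sup>\<theta>\<^sup>S\<close> against the normal density and
  expanding the quadratic form splits off the constant \<open>exp (- x\<^sup>* \<bullet> \<Sigma>\<^sup>-\<^sup>1 x\<^sup>* / 2)\<close> and leaves the
  expectation of \<open>v\<close> under the centred normal law with covariance \<open>\<Sigma>\<close>, which is the image of the
  standard one under \<open>\<Sigma>\<^sup>1\<^sup>/\<^sup>2\<close>.\<close>

section \<open>The positive definite square root\<close>

lemma symmetric_matrix_inner:
  fixes A :: "real ^ 'n ^ 'n"
  assumes "transpose A = A"
  shows "x \<bullet> (A *v y) = (A *v x) \<bullet> y"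
  by (metis assms dot_lmul_matrix transpose_matrix_vector)

lemma positive_definite_inner:
  assumes "positive_definite A"
  shows "x \<bullet> (A *v y) = (A *v x) \<bullet> y"
  using assms symmetric_matrix_inner unfolding positive_definite_def by blast

lemma positive_definite_eq_0:
  assumes "positive_definite A" "A *v x = 0"
  shows "x = 0"
  using assms unfolding positive_definite_def by fastforce

lemma positive_definite_invertible:
  assumes "positive_definite A"
  shows "invertible A"
  using positive_definite_eq_0[OF assms]
  by (simp add: invertible_left_inverse matrix_left_invertible_ker)

text \<open>With \<open>D = R - T\<close> and \<open>P = R + T\<close>, the equation \<open>R\<^sup>2 = T\<^sup>2\<close> says \<open>P D + D P = 0\<close>; multiplying by
  \<open>D\<close> and taking traces gives \<open>tr (D P D) = 0\<close>, so \<open>D = 0\<close>.\<close>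

lemma positive_definite_sqrt_unique:
  fixes R T :: "real ^ 'n ^ 'n"
  assumes R: "positive_definite R" and T: "positive_definite T" and eq: "R ** R = T ** T"
  shows "R = T"
proof -
  define D where "D = R - T"
  define P where "P = R + T"
  have symD: "transpose D = D"
    using R T by (simp add: D_def positive_definite_def transpose_def vec_eq_iff)
  have P: "x \<bullet> (P *v x) > 0" if "x \<noteq> 0" for x
    using R T that unfolding positive_definite_def P_def
    by (simp add: matrix_vector_mult_add_rdistrib inner_add_right add_pos_pos)
  have "P ** D + D ** P = 0"
    using eq by (simp add: P_def D_def vec_eq_iff matrix_matrix_mult_def algebra_simps
        sum.distrib sum_subtractf)
  then have "P ** D = - (D ** P)"
    by (simp add: eq_neg_iff_add_eq_0)
  then have "D ** (P ** D) = - (D ** (D ** P))"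
    by (simp add: vec_eq_iff matrix_matrix_mult_def sum_negf)
  moreover have "trace (D ** (D ** P)) = trace (D ** (P ** D))"
    by (metis matrix_mul_assoc trace_mul_sym)
  ultimately have "trace (D ** (P ** D)) = - trace (D ** (P ** D))"
    by (simp add: trace_def sum_negf)
  then have tr: "trace (D ** (P ** D)) = 0" by simp
  \<comment> \<open>Each diagonal entry of \<open>D P D\<close> is the quadratic form of
    \<open>P\<close> at a column of \<open>D\<close>, so the vanishing trace is a sum of nonnegative
    terms.\<close>
  have "(D ** (P ** D)) $ k $ k = (D *v axis k 1) \<bullet> (P *v (D *v axis k 1))" for k
  proof -
    have "(D ** (P ** D)) $ k $ k = axis k 1 \<bullet> ((D ** (P ** D)) *v axis k 1)"
      by (simp add: inner_axis' matrix_vector_mult_basis column_def)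
    also have "\<dots> = axis k 1 \<bullet> (D *v (P *v (D *v axis k 1)))"
      by (simp add: matrix_vector_mul_assoc matrix_mul_assoc)
    finally show ?thesis
      using symmetric_matrix_inner[OF symD] by simp
  qed
  then have s: "(\<Sum>k\<in>UNIV. (D *v axis k 1) \<bullet> (P *v (D *v axis k 1))) = 0"
    using tr by (simp add: trace_def)
  have nn: "x \<bullet> (P *v x) \<ge> 0" for x
    using P[of x] by (cases "x = 0") auto
  have "(D *v axis k 1) \<bullet> (P *v (D *v axis k 1)) = 0" for k
    using s nn by (subst (asm) sum_nonneg_eq_0_iff) auto
  then have "D *v axis k 1 = 0" for k
    using P by (metis less_irrefl)
  then have "D = 0"
    by (simp add: matrix_vector_mult_basis column_def vec_eq_iff)
  then show ?thesis by (simp add: D_def)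
qed

text \<open>By compactness the quadratic form attains its minimum on the unit sphere; this minimum
  is positive and serves as \<open>m\<close>, and homogeneity of degree 2 extends the bound to all
  vectors.\<close>

lemma positive_definite_coercive:
  fixes A :: "real ^ 'n ^ 'n"
  assumes "positive_definite A"
  obtains m where "m > 0" "\<And>x. x \<bullet> (A *v x) \<ge> m * (norm x)\<^sup>2"
proof -
  have "compact (sphere (0::real^'n) 1)" by simp
  \<comment> \<open>Any unit vector will do here: it only shows that the sphere is nonempty.\<close>
  moreover have "axis undefined 1 \<in> sphere (0::real^'n) 1" by simp
  moreover have "continuous_on (sphere 0 1) (\<lambda>x. x \<bullet> (A *v x))"
    by (intro continuous_intros linear_continuous_on linear_linear[THEN iffD1]) auto
  ultimately obtain u where u: "u \<in> sphere 0 1"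
    "\<And>x. x \<in> sphere 0 1 \<Longrightarrow> u \<bullet> (A *v u) \<le> x \<bullet> (A *v x)"
    using continuous_attains_inf[of "sphere (0::real^'n) 1" "\<lambda>x. x \<bullet> (A *v x)"] by blast
  have "u \<bullet> (A *v u) * (norm x)\<^sup>2 \<le> x \<bullet> (A *v x)" for x
  proof (cases "x = 0")
    case False
    then have "u \<bullet> (A *v u) \<le> (x /\<^sub>R norm x) \<bullet> (A *v (x /\<^sub>R norm x))"
      by (intro u(2)) simp
    then show ?thesis using False
      by (simp add: matrix_vector_mult_scaleR field_simps power2_eq_square)
  qed simp
  moreover have "u \<bullet> (A *v u) > 0"
    using u(1) assms unfolding positive_definite_def by (metis mem_sphere_0 norm_zero zero_neq_one)
  ultimately show thesis using that by blast
qed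

text \<open>For small \<open>c > 0\<close> the operator \<open>B = 1 - c A\<close> has norm less than 1, so \<open>Y \<mapsto> (B + Y\<^sup>2) / 2\<close> is a
  contraction on the self-adjoint operators of norm at most \<open>b\<close>, a bound for the norm of \<open>B\<close>.
  Its fixed point satisfies \<open>(1 - Y)\<^sup>2 = c A\<close>.\<close>

lemma positive_definite_sqrt_exists:
  fixes A :: "real ^ 'n ^ 'n"
  assumes A: "positive_definite A"
  shows "\<exists>R. positive_definite R \<and> R ** R = A"
proof -
  obtain m where m: "m > 0" "\<And>x. x \<bullet> (A *v x) \<ge> m * (norm x)\<^sup>2"
    using positive_definite_coercive[OF A] by blast
  have bl: "bounded_linear ((*v) A)" by (simp add: linear_linear)
  obtain K where K: "K > 0" "\<And>x. norm (A *v x) \<le> norm x * K"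
    using bounded_linear.pos_bounded[OF bl] by blast
  \<comment> \<open>This value minimises \<open>1 - 2 * c * m + c\<^sup>2 * K\<^sup>2\<close>, which
    bounds the squared norm of \<open>B\<close>; the minimum is
    \<open>1 - m\<^sup>2 / K\<^sup>2\<close>.\<close>
  define c where "c = m / K\<^sup>2"
  have c: "c > 0" using m K by (simp add: c_def)
  define B where "B = id_blinfun - c *\<^sub>R Blinfun ((*v) A)"
  have B: "blinfun_apply B x = x - c *\<^sub>R (A *v x)" for x
    by (simp add: B_def blinfun.bilinear_simps bounded_linear_Blinfun_apply[OF bl])
  \<comment> \<open>The maximum with 0 makes the square root \<open>b\<close> available without a
    proof of \<open>m \<le> K\<close>.\<close>
  define q where "q = max 0 (1 - m\<^sup>2 / K\<^sup>2)"
  define b where "b = sqrt q"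
  have q: "0 \<le> q" "q < 1" using m K by (auto simp: q_def)
  have b: "0 \<le> b" "b < 1" using q by (auto simp: b_def)
  have "norm (blinfun_apply B x) \<le> b * norm x" for x
  proof -
    have "(norm (x - c *\<^sub>R (A *v x)))\<^sup>2 =
        (norm x)\<^sup>2 - 2 * c * (x \<bullet> (A *v x)) + c\<^sup>2 * (norm (A *v x))\<^sup>2"
      unfolding power2_norm_eq_inner
      by (simp add: inner_diff_left inner_diff_right inner_commute power2_eq_square algebra_simps)
    also have "\<dots> \<le> (norm x)\<^sup>2 - 2 * c * (m * (norm x)\<^sup>2) + c\<^sup>2 * (norm x * K)\<^sup>2"
      using c m K by (intro add_mono diff_mono mult_left_mono power_mono) auto
    also have "\<dots> = (1 - m\<^sup>2 / K\<^sup>2) * (norm x)\<^sup>2"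
      using K by (simp add: c_def field_simps power2_eq_square)
    also have "\<dots> \<le> q * (norm x)\<^sup>2"
      by (intro mult_right_mono) (auto simp: q_def)
    also have "\<dots> = (b * norm x)\<^sup>2"
      using q by (simp add: b_def power_mult_distrib)
    finally show ?thesis
      unfolding B by (rule power2_le_imp_le) (use b in auto)
  qed
  then have normB: "norm B \<le> b"
    by (intro norm_blinfun_bound b)
  define S where "S = {Y::(real^'n) \<Rightarrow>\<^sub>L (real^'n). norm Y \<le> b \<and>
    (\<forall>x y. x \<bullet> blinfun_apply Y y = blinfun_apply Y x \<bullet> y)}"
  define F where "F Y = (1/2) *\<^sub>R (B + (Y o\<^sub>L Y))" for Y
  have "closed S"
    unfolding S_def
    by (intro closed_Collect_conj closed_Collect_all closed_Collect_le closed_Collect_eq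
        continuous_intros)
  then have "Topological_Spaces.complete S" by (simp add: complete_eq_closed)
  moreover have "0 \<in> S" using b by (simp add: S_def)
  moreover have "F ` S \<subseteq> S"
  proof clarsimp
    fix Y assume Y: "Y \<in> S"
    have "norm (B + (Y o\<^sub>L Y)) \<le> b + b * b"
      using normB Y norm_blinfun_compose[of Y Y] b
        mult_mono[of "norm Y" b "norm Y" b] norm_triangle_ineq[of B "Y o\<^sub>L Y"]
      by (force simp: S_def)
    also have "\<dots> \<le> b + b" using b by (simp add: mult_left_le)
    finally have "norm (F Y) \<le> b" by (simp add: F_def)
    then show "F Y \<in> S"
      using Y by (simp add: S_def F_def B blinfun.bilinear_simps inner_add_left inner_add_right
          inner_diff_left inner_diff_right positive_definite_inner[OF A])
  qed
  moreover have "dist (F X) (F Y) \<le> b * dist X Y" if "X \<in> S" "Y \<in> S" for X Y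
  proof -
    \<comment> \<open>A difference of squares for operators that need not commute; the factor 1/2
      absorbs the two terms, each of norm at most \<open>b * norm (X - Y)\<close>.\<close>
    have "F X - F Y = (1/2) *\<^sub>R ((X o\<^sub>L (X - Y)) + ((X - Y) o\<^sub>L Y))"
      by (rule blinfun_eqI) (simp add: F_def blinfun.bilinear_simps algebra_simps)
    moreover have "norm (X o\<^sub>L (X - Y)) \<le> b * norm (X - Y)"
      by (rule order_trans[OF norm_blinfun_compose]) (use that in \<open>simp add: S_def mult_right_mono\<close>)
    moreover have "norm ((X - Y) o\<^sub>L Y) \<le> b * norm (X - Y)"
      by (rule order_trans[OF norm_blinfun_compose])
        (use that in \<open>simp add: S_def mult.commute[of b] mult_left_mono\<close>)
    ultimately show ?thesis
      using norm_triangle_ineq[of "X o\<^sub>L (X - Y)" "(X - Y) o\<^sub>L Y"] by (simp add: dist_norm)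
  qed
  ultimately have "\<exists>!Y\<in>S. F Y = Y"
    by (intro Banach_fix[OF _ _ b]) auto
  then obtain Y where Y: "Y \<in> S" "F Y = Y" by blast
  define y where "y = blinfun_apply Y"
  have lin: "linear y" by (simp add: y_def blinfun.bounded_linear_right bounded_linear.linear)
  have twice_y: "2 *\<^sub>R y x = x - c *\<^sub>R (A *v x) + y (y x)" for x
    using arg_cong[OF Y(2), of "\<lambda>T. 2 *\<^sub>R blinfun_apply T x"]
    by (simp add: F_def B blinfun.bilinear_simps y_def)
  \<comment> \<open>Since \<open>1 - Y\<close> squares to \<open>c A\<close>, it is divided by
    \<open>sqrt c\<close>.\<close>
  define R where "R = matrix (\<lambda>x. (1 / sqrt c) *\<^sub>R (x - y x))"
  have R: "R *v x = (1 / sqrt c) *\<^sub>R (x - y x)" for x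
    unfolding R_def
    by (rule matrix_works) (auto intro!: linear_compose_scale_right linear_compose_sub lin
        simp: linear_matrix_vector_mul_eq linear_ident)
  have "R *v (R *v x) = A *v x" for x
  proof -
    have "R *v (R *v x) = (1 / sqrt c * (1 / sqrt c)) *\<^sub>R (x - 2 *\<^sub>R y x + y (y x))"
      by (simp add: R linear_diff[OF lin] linear_scale[OF lin] scaleR_2 algebra_simps)
    also have "x - 2 *\<^sub>R y x + y (y x) = c *\<^sub>R (A *v x)"
      by (subst twice_y) simp
    finally show ?thesis using c by simp
  qed
  then have RR: "R ** R = A"
    by (simp add: matrix_eq matrix_vector_mul_assoc)
  have sym: "x \<bullet> (R *v z) = (R *v x) \<bullet> z" for x z
    using Y(1) by (simp add: R S_def y_def inner_diff_left inner_diff_right)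
  have "transpose R = R"
    unfolding matrix_eq
    by (metis dot_lmul_matrix sym transpose_matrix_vector vector_eq_rdot)
  \<comment> \<open>As \<open>Y\<close> has norm at most \<open>b < 1\<close>, the form of
    \<open>1 - Y\<close> stays positive.\<close>
  moreover have "x \<bullet> (R *v x) > 0" if "x \<noteq> 0" for x
  proof -
    have "x \<bullet> y x \<le> norm x * norm (y x)" by (rule norm_cauchy_schwarz)
    also have "\<dots> \<le> norm x * (b * norm x)"
      using Y(1) norm_blinfun[of Y x] mult_right_mono[of "norm Y" b "norm x"]
      by (intro mult_left_mono) (auto simp: S_def y_def)
    also have "\<dots> < norm x * norm x" using b that by simp
    finally show ?thesis
      using c by (simp add: R inner_diff_right power2_norm_eq_inner[symmetric] power2_eq_square)
  qed
  ultimately show ?thesis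
    using RR unfolding positive_definite_def by blast
qed

lemma matrix_sqrt_properties:
  assumes "positive_definite A"
  shows "positive_definite (matrix_sqrt A)" "matrix_sqrt A ** matrix_sqrt A = A"
proof -
  have "\<exists>!R. positive_definite R \<and> R ** R = A"
    using positive_definite_sqrt_exists[OF assms] positive_definite_sqrt_unique by metis
  from theI'[OF this]
  show "positive_definite (matrix_sqrt A)" "matrix_sqrt A ** matrix_sqrt A = A"
    unfolding matrix_sqrt_def by auto
qed

section \<open>Lebesgue integrals under translations and linear maps\<close>

lemma nn_integral_lborel_translate:
  fixes f :: "'a::euclidean_space \<Rightarrow> ennreal"
  assumes [measurable]: "f \<in> borel_measurable borel"
  shows "(\<integral>\<^sup>+x. f (a + x) \<partial>lborel) = (\<integral>\<^sup>+x. f x \<partial>lborel)"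
  by (subst (2) lborel_distr_plus[of a, symmetric]) (simp add: nn_integral_distr)

lemma integral_lborel_translate:
  fixes f :: "'a::euclidean_space \<Rightarrow> real"
  assumes [measurable]: "f \<in> borel_measurable borel"
  shows "(\<integral>x. f (a + x) \<partial>lborel) = (\<integral>x. f x \<partial>lborel)"
  by (subst (2) lborel_distr_plus[of a, symmetric]) (simp add: integral_distr)

text \<open>Uniqueness of Haar measure, as Fubini's theorem gives it: this determines how Lebesgue measure
  scales under a linear map without computing a determinant.\<close>

lemma nn_integral_linear_substitution:
  fixes f g :: "'a::euclidean_space \<Rightarrow> ennreal"
  assumes L: "linear L" "surj L"
    and [measurable]: "f \<in> borel_measurable borel" "g \<in> borel_measurable borel"
    and even: "\<And>x. g (- x) = g x"
  shows "(\<integral>\<^sup>+x. f (L x) \<partial>lborel) * (\<integral>\<^sup>+x. g x \<partial>lborel) =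
    (\<integral>\<^sup>+x. f x \<partial>lborel) * (\<integral>\<^sup>+x. g (L x) \<partial>lborel)"
proof -
  have [measurable]: "L \<in> borel_measurable borel"
    using L(1) by (intro borel_measurable_continuous_onI linear_continuous_on) (simp add: linear_linear)
  \<comment> \<open>Surjectivity turns a translation after \<open>L\<close> into a translation
    before it.\<close>
  have shift: "(\<integral>\<^sup>+x. h (L x + y) \<partial>lborel) = (\<integral>\<^sup>+x. h (L x) \<partial>lborel)"
    if [measurable]: "h \<in> borel_measurable borel" for h :: "'a \<Rightarrow> ennreal" and y
  proof -
    obtain a where "y = L a" using L(2) by auto
    then show ?thesis
      using nn_integral_lborel_translate[of "\<lambda>x. h (L x)" a]
      by (simp add: linear_add[OF L(1)] add.commute)
  qed
  \<comment> \<open>By \<open>shift\<close>, the inner integral does not depend on \<open>y\<close>,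
    so the product becomes a double integral in which \<open>x\<close> and \<open>y\<close> can be
    exchanged.\<close>
  have "(\<integral>\<^sup>+x. f (L x) \<partial>lborel) * (\<integral>\<^sup>+x. g x \<partial>lborel) =
      (\<integral>\<^sup>+y. (\<integral>\<^sup>+x. f (L x + y) \<partial>lborel) * g y \<partial>lborel)"
    by (simp add: shift nn_integral_cmult)
  also have "\<dots> = (\<integral>\<^sup>+y. \<integral>\<^sup>+x. f (L x + y) * g y \<partial>lborel \<partial>lborel)"
    by (simp add: nn_integral_multc)
  also have "\<dots> = (\<integral>\<^sup>+x. \<integral>\<^sup>+y. f (L x + y) * g y \<partial>lborel \<partial>lborel)"
    by (rule lborel_pair.Fubini') measurable
  also have "\<dots> = (\<integral>\<^sup>+x. \<integral>\<^sup>+y. f y * g (y - L x) \<partial>lborel \<partial>lborel)"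
  proof -
    have "(\<integral>\<^sup>+y. f (L x + y) * g y \<partial>lborel) = (\<integral>\<^sup>+y. f y * g (y - L x) \<partial>lborel)" for x
      using nn_integral_lborel_translate[of "\<lambda>y. f y * g (y - L x)" "L x"] by simp
    then show ?thesis by simp
  qed
  also have "\<dots> = (\<integral>\<^sup>+y. \<integral>\<^sup>+x. f y * g (y - L x) \<partial>lborel \<partial>lborel)"
    by (rule lborel_pair.Fubini') measurable
  \<comment> \<open>Evenness replaces \<open>g (y - L x)\<close> by \<open>g (L x - y)\<close>, to
    which \<open>shift\<close> applies.\<close>
  also have "\<dots> = (\<integral>\<^sup>+y. f y * (\<integral>\<^sup>+x. g (L x + - y) \<partial>lborel) \<partial>lborel)"
    using even[of "_ - _"] by (simp add: nn_integral_cmult)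
  also have "\<dots> = (\<integral>\<^sup>+x. f x \<partial>lborel) * (\<integral>\<^sup>+x. g (L x) \<partial>lborel)"
    by (subst shift) (simp_all add: nn_integral_multc)
  finally show ?thesis .
qed

section \<open>The multivariate normal law and its representation by a standard normal
  vector\<close>

lemma measurable_matrix_vector_mult [measurable]:
  fixes A :: "real ^ 'n ^ 'm"
  shows "(*v) A \<in> borel_measurable borel"
  by (intro borel_measurable_continuous_onI linear_continuous_on) (simp add: linear_linear)

lemma measurable_exp_vec [measurable]: "exp_vec \<in> borel_measurable borel"
  unfolding exp_vec_def by (intro borel_measurable_continuous_onI continuous_intros)

definition mv_normal_density :: "real ^ 'n \<Rightarrow> real ^ 'n ^ 'n \<Rightarrow> real ^ 'n \<Rightarrow> real" where
  "mv_normal_density \<mu> \<Sigma> x =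
    exp (- ((x - \<mu>) \<bullet> (matrix_inv \<Sigma> *v (x - \<mu>))) / 2) / sqrt ((2 * pi) ^ CARD('n) * det \<Sigma>)"

lemma mv_normal_eq: "mv_normal \<mu> \<Sigma> = density lborel (\<lambda>x. ennreal (mv_normal_density \<mu> \<Sigma> x))"
  by (simp add: mv_normal_def mv_normal_density_def)

lemma measurable_mv_normal_density [measurable]:
  "mv_normal_density \<mu> \<Sigma> \<in> borel_measurable borel"
  unfolding mv_normal_density_def by measurable

lemma sets_mv_normal [measurable_cong]: "sets (mv_normal \<mu> \<Sigma>) = sets borel"
  by (simp add: mv_normal_def)

lemma space_mv_normal [simp]: "space (mv_normal \<mu> \<Sigma>) = UNIV"
  by (simp add: mv_normal_def)

text \<open>The determinant is the square of that of the square root, which is invertible.\<close>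

lemma positive_definite_det_pos:
  assumes "positive_definite A"
  shows "det A > 0"
proof -
  have "det A = (det (matrix_sqrt A))\<^sup>2"
    by (metis assms det_mul matrix_sqrt_properties(2) power2_eq_square)
  moreover have "det (matrix_sqrt A) \<noteq> 0"
    using assms invertible_det_nz matrix_sqrt_properties(1) positive_definite_invertible by blast
  ultimately show ?thesis by simp
qed

lemma mv_normal_density_pos:
  fixes \<Sigma> :: "real ^ 'n ^ 'n"
  assumes "positive_definite \<Sigma>"
  shows "mv_normal_density \<mu> \<Sigma> x > 0"
  using positive_definite_det_pos[OF assms] by (simp add: mv_normal_density_def)

lemma nn_integral_mv_normal_density:
  assumes "prob_space (mv_normal \<mu> \<Sigma>)"
  shows "(\<integral>\<^sup>+x. ennreal (mv_normal_density \<mu> \<Sigma> x) \<partial>lborel) = 1"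
  using prob_space.emeasure_space_1[OF assms] by (simp add: mv_normal_eq emeasure_density)

lemma integral_mv_normal:
  assumes "positive_definite \<Sigma>" "f \<in> borel_measurable borel"
  shows "(\<integral>x. f x \<partial>mv_normal \<mu> \<Sigma>) = (\<integral>x. mv_normal_density \<mu> \<Sigma> x * f x \<partial>lborel)"
  unfolding mv_normal_eq using assms
  by (subst integral_density) (auto intro!: less_imp_le mv_normal_density_pos)

text \<open>Transfers the total mass to the centred density, whose evenness the linear substitution
  requires.\<close>

lemma prob_space_mv_normal_translate:
  assumes "prob_space (mv_normal \<mu> \<Sigma>)"
  shows "prob_space (mv_normal 0 \<Sigma>)"
proof
  have "(\<integral>\<^sup>+x. ennreal (mv_normal_density 0 \<Sigma> x) \<partial>lborel) =
      (\<integral>\<^sup>+x. ennreal (mv_normal_density \<mu> \<Sigma> (\<mu> + x)) \<partial>lborel)"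
    by (simp add: mv_normal_density_def)
  also have "\<dots> = 1"
    using nn_integral_mv_normal_density[OF assms]
    by (subst nn_integral_lborel_translate[of "\<lambda>x. ennreal (mv_normal_density \<mu> \<Sigma> x)"]) auto
  finally show "emeasure (mv_normal 0 \<Sigma>) (space (mv_normal 0 \<Sigma>)) = 1"
    by (simp add: mv_normal_eq emeasure_density)
qed

lemma matrix_inv_properties:
  assumes "invertible A"
  shows "A ** matrix_inv A = mat 1" "matrix_inv A ** A = mat 1"
  using someI_ex[OF assms[unfolded invertible_def]] by (simp_all add: matrix_inv_def)

lemma matrix_inv_mult_vector:
  assumes "invertible A"
  shows "A *v (matrix_inv A *v x) = x"
  using matrix_inv_properties[OF assms] by (simp add: matrix_vector_mul_assoc)

lemma matrix_inv_unique_right: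
  fixes A B :: "real ^ 'n ^ 'n"
  assumes "A ** B = mat 1"
  shows "matrix_inv A = B"
  by (metis assms invertible_right_inverse matrix_inv_properties(2) matrix_mul_assoc matrix_mul_lid
      matrix_mul_rid)

text \<open>With \<open>R\<close> the square root, injectivity of \<open>R\<close> gives
  \<open>R \<Sigma>^-1 R z = z\<close>; symmetry of \<open>R\<close> then moves one factor across
  the inner product.\<close>

lemma matrix_sqrt_quadratic_form:
  assumes "positive_definite \<Sigma>"
  shows "(matrix_sqrt \<Sigma> *v z) \<bullet> (matrix_inv \<Sigma> *v (matrix_sqrt \<Sigma> *v z)) = z \<bullet> z"
proof -
  let ?R = "matrix_sqrt \<Sigma>"
  define y where "y = matrix_inv \<Sigma> *v (?R *v z)"
  note R = matrix_sqrt_properties[OF assms]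
  have "?R *v (?R *v y) = ?R *v z"
    unfolding y_def
    by (metis R(2) assms matrix_inv_mult_vector matrix_vector_mul_assoc positive_definite_invertible)
  then have "?R *v (?R *v y - z) = 0"
    by (simp add: matrix_vector_mult_diff_distrib)
  then have "?R *v y = z"
    using positive_definite_eq_0[OF R(1)] by fastforce
  then show ?thesis
    unfolding y_def[symmetric] by (metis R(1) positive_definite_inner)
qed

text \<open>The standard density is a constant multiple of the centred one composed with the square
  root. That both have total mass 1 fixes the scaling factor of the substitution, in place of a
  Jacobian.\<close>

lemma distr_mv_normal_matrix_sqrt:
  fixes \<Sigma> :: "real ^ 'n ^ 'n"
  assumes \<Sigma>: "positive_definite \<Sigma>"
    and prob: "prob_space (mv_normal 0 \<Sigma>)" "prob_space (mv_normal 0 (mat 1 :: real ^ 'n ^ 'n))"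
  shows "distr (mv_normal 0 (mat 1)) borel ((*v) (matrix_sqrt \<Sigma>)) = mv_normal 0 \<Sigma>"
proof (rule measure_eqI)
  let ?R = "matrix_sqrt \<Sigma>"
  let ?g = "mv_normal_density 0 \<Sigma>" and ?g1 = "mv_normal_density 0 (mat 1 :: real ^ 'n ^ 'n)"
  define c where "c = sqrt (det \<Sigma>)"
  have c: "c > 0" using positive_definite_det_pos[OF \<Sigma>] by (simp add: c_def)
  have inv1: "matrix_inv (mat 1 :: real ^ 'n ^ 'n) = mat 1"
    by (rule matrix_inv_unique_right) simp
  \<comment> \<open>The exponents agree, and the normalisations differ by
    \<open>sqrt (det \<Sigma>)\<close>.\<close>
  have dens: "?g1 z = c * ?g (?R *v z)" for z
    using c matrix_sqrt_quadratic_form[OF \<Sigma>, of z]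
    by (simp add: mv_normal_density_def inv1 c_def real_sqrt_mult)
  have nn: "?g x \<ge> 0" for x
    using mv_normal_density_pos[OF \<Sigma>] less_imp_le by blast
  have surj: "surj ((*v) ?R)"
    by (metis \<Sigma> invertible_right_inverse matrix_right_invertible_surjective
        matrix_sqrt_properties(1) positive_definite_invertible)
  have total: "ennreal c * (\<integral>\<^sup>+z. ennreal (?g (?R *v z)) \<partial>lborel) = 1"
    using nn_integral_mv_normal_density[OF prob(2)] c nn
    by (simp add: dens ennreal_mult nn_integral_cmult)
  fix A assume "A \<in> sets (distr (mv_normal 0 (mat 1)) borel ((*v) ?R))"
  then have [measurable]: "A \<in> sets borel" by simp
  define f where "f x = ennreal (?g x) * indicator A x" for x
  have [measurable]: "f \<in> borel_measurable borel" unfolding f_def by measurable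
  have "emeasure (distr (mv_normal 0 (mat 1)) borel ((*v) ?R)) A =
      (\<integral>\<^sup>+z. ennreal (?g1 z) * indicator A (?R *v z) \<partial>lborel)"
    using measurable_sets[OF measurable_matrix_vector_mult \<open>A \<in> sets borel\<close>, of ?R]
    by (simp add: emeasure_distr mv_normal_eq emeasure_density indicator_def)
  also have "\<dots> = ennreal c * (\<integral>\<^sup>+z. f (?R *v z) \<partial>lborel)"
    using c nn by (simp add: dens f_def ennreal_mult nn_integral_cmult mult.assoc)
  \<comment> \<open>The centred density itself is the even test function \<open>g\<close>, of
    integral 1.\<close>
  also have "(\<integral>\<^sup>+z. f (?R *v z) \<partial>lborel) =
      (\<integral>\<^sup>+z. f z \<partial>lborel) * (\<integral>\<^sup>+z. ennreal (?g (?R *v z)) \<partial>lborel)"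
    using nn_integral_linear_substitution[OF _ surj, of f "\<lambda>x. ennreal (?g x)"]
      nn_integral_mv_normal_density[OF prob(1)]
      linear_neg[OF matrix_vector_mul_linear, of "matrix_inv \<Sigma>"]
    by (simp add: mv_normal_density_def)
  also have "ennreal c * \<dots> = (\<integral>\<^sup>+z. f z \<partial>lborel)"
    using total by (metis mult.left_commute mult.right_neutral)
  also have "\<dots> = emeasure (mv_normal 0 \<Sigma>) A"
    by (simp add: f_def mv_normal_eq emeasure_density)
  finally show "emeasure (distr (mv_normal 0 (mat 1)) borel ((*v) ?R)) A =
    emeasure (mv_normal 0 \<Sigma>) A" .
qed (simp add: sets_mv_normal)

section \<open>The exact factorisation of the transform\<close>

lemma sum_exp_vec_pos: "1 \<bullet> exp_vec x > (0::real)"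
  by (simp add: inner_vec_def exp_vec_def sum_pos)

lemma measurable_v_fun [measurable]: "v_fun \<mu> \<Sigma> \<theta> i xs \<in> borel_measurable borel"
  unfolding v_fun_def by measurable

theorem propositionA1:
  fixes \<mu> xs :: "real ^ 'n" and \<Sigma> :: "real ^ 'n ^ 'n"
    and \<theta> :: real and i :: nat
    and M :: "'a measure" and S :: "'a \<Rightarrow> real"
    and N :: "'b measure" and Z :: "'b \<Rightarrow> real ^ 'n"
  assumes "CARD('n) \<ge> 2"
    and "positive_definite \<Sigma>"
    and "\<theta> \<ge> 0"
    and "prob_space M" and "S \<in> borel_measurable M" and "distr M borel S = SLN \<mu> \<Sigma>"
    and "is_arg_min (h_fun \<mu> \<Sigma> \<theta> i) (\<lambda>x. x \<in> UNIV) xs"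
    and "invertible (H_mat \<mu> \<Sigma> i xs)"
    and "prob_space N" and "Z \<in> borel_measurable N" and "distr N borel Z = mv_normal 0 (mat 1)"
  shows "prob_space.expectation M (\<lambda>\<omega>. S \<omega> ^ i * exp (- \<theta> * S \<omega>)) =
    L_tilde \<mu> \<Sigma> \<theta> i xs *
      (sqrt (det (\<Sigma> ** H_mat \<mu> \<Sigma> i xs)) * inverse (v_fun \<mu> \<Sigma> \<theta> i xs 0) *
        prob_space.expectation N (\<lambda>\<omega>. v_fun \<mu> \<Sigma> \<theta> i xs (matrix_sqrt \<Sigma> *v Z \<omega>)))"
proof -
  note \<Sigma> = assms(2)
  note [measurable] = assms(5,10)
  let ?Q = "matrix_inv \<Sigma>" and ?v = "v_fun \<mu> \<Sigma> \<theta> i xs"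
  define F where "F x = (1 \<bullet> exp_vec x) ^ i * exp (- \<theta> * (1 \<bullet> exp_vec x))" for x :: "real ^ 'n"
  have [measurable]: "F \<in> borel_measurable borel" unfolding F_def by measurable
  have prob: "prob_space (mv_normal \<mu> \<Sigma>)"
  \<comment> \<open>The total mass need not be computed: the law of \<open>S\<close> has mass 1.\<close>
  proof (rule prob_space_distrD)
    show "(\<lambda>x. 1 \<bullet> exp_vec x) \<in> measurable (mv_normal \<mu> \<Sigma>) (borel :: real measure)"
      by measurable
    show "prob_space (distr (mv_normal \<mu> \<Sigma>) borel (\<lambda>x. 1 \<bullet> exp_vec x))"
      using prob_space.prob_space_distr[OF assms(4,5)] assms(6) by (simp add: SLN_def)
  qed
  have prob1: "prob_space (mv_normal 0 (mat 1 :: real ^ 'n ^ 'n))"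
    using prob_space.prob_space_distr[OF assms(9,10)] assms(11) by simp
  have symQ: "x \<bullet> (?Q *v y) = (?Q *v x) \<bullet> y" for x y
    by (metis \<Sigma> matrix_inv_mult_vector positive_definite_inner positive_definite_invertible)
  define K where "K = exp (- (xs \<bullet> (?Q *v xs)) / 2)"

  \<comment> \<open>The pointwise identity behind the result: shifting the normal density by
    \<open>xs\<close> yields the factor \<open>K\<close> and the exponential of a linear term, which
    is the one contained in \<open>v_fun\<close>.\<close>
  have tilt: "mv_normal_density \<mu> \<Sigma> ((\<mu> + xs) + z) * F ((\<mu> + xs) + z) =
      K * (mv_normal_density 0 \<Sigma> z * ?v z)" for z
  proof -
    define s where "s = 1 \<bullet> exp_vec (\<mu> + xs + z)"
    \<comment> \<open>Positivity of \<open>s\<close> allows \<open>s ^ i\<close> to be written as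
      \<open>exp (real i * ln s)\<close>.\<close>
    have "F (\<mu> + xs + z) = exp (real i * ln s - \<theta> * s)"
      unfolding F_def s_def[symmetric] using sum_exp_vec_pos[of "\<mu> + xs + z"]
      by (simp add: s_def exp_diff exp_minus exp_of_nat_mult field_simps)
    then have F: "F (\<mu> + xs + z) = ?v z * exp (xs \<bullet> (?Q *v z))"
      by (simp add: v_fun_def s_def exp_add[symmetric])
    \<comment> \<open>Symmetry of the inverse merges the two cross terms; halving then leaves
      exactly the linear term of \<open>v_fun\<close>.\<close>
    have "(xs + z) \<bullet> (?Q *v (xs + z)) =
        xs \<bullet> (?Q *v xs) + 2 * (xs \<bullet> (?Q *v z)) + z \<bullet> (?Q *v z)"
      using symQ[of z xs]
      by (simp add: matrix_vector_right_distrib inner_add_left inner_add_right inner_commute)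
    then have "exp (- ((xs + z) \<bullet> (?Q *v (xs + z))) / 2) =
        K * exp (- (z \<bullet> (?Q *v z)) / 2) * exp (- (xs \<bullet> (?Q *v z)))"
      by (simp add: K_def exp_add[symmetric] field_simps)
    then have "mv_normal_density \<mu> \<Sigma> (\<mu> + xs + z) =
        K * mv_normal_density 0 \<Sigma> z * exp (- (xs \<bullet> (?Q *v z)))"
      by (simp add: mv_normal_density_def add.assoc)
    then show ?thesis by (simp only: F exp_minus) simp
  qed

  have "(\<integral>\<omega>. S \<omega> ^ i * exp (- \<theta> * S \<omega>) \<partial>M) = (\<integral>s. s ^ i * exp (- \<theta> * s) \<partial>distr M borel S)"
    by (subst integral_distr) auto
  also have "\<dots> = (\<integral>x. F x \<partial>mv_normal \<mu> \<Sigma>)"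
    unfolding assms(6) SLN_def F_def by (subst integral_distr) auto
  also have "\<dots> = (\<integral>x. mv_normal_density \<mu> \<Sigma> x * F x \<partial>lborel)"
    by (rule integral_mv_normal[OF \<Sigma>]) measurable
  also have "\<dots> = (\<integral>z. mv_normal_density \<mu> \<Sigma> ((\<mu> + xs) + z) * F ((\<mu> + xs) + z) \<partial>lborel)"
    by (rule integral_lborel_translate[symmetric]) measurable
  also have "\<dots> = K * (\<integral>z. mv_normal_density 0 \<Sigma> z * ?v z \<partial>lborel)"
    unfolding tilt by simp
  also have "\<dots> = K * (\<integral>z. ?v z \<partial>mv_normal 0 \<Sigma>)"
    by (subst integral_mv_normal[OF \<Sigma>]) auto
  also have "(\<integral>z. ?v z \<partial>mv_normal 0 \<Sigma>) = (\<integral>z. ?v (matrix_sqrt \<Sigma> *v z) \<partial>distr N borel Z)"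
    unfolding assms(11)
      distr_mv_normal_matrix_sqrt[OF \<Sigma> prob_space_mv_normal_translate[OF prob] prob1, symmetric]
    by (subst integral_distr) auto
  also have "\<dots> = (\<integral>\<omega>. ?v (matrix_sqrt \<Sigma> *v Z \<omega>) \<partial>N)"
    by (subst integral_distr) auto
  finally have main: "(\<integral>\<omega>. S \<omega> ^ i * exp (- \<theta> * S \<omega>) \<partial>M) =
    K * (\<integral>\<omega>. ?v (matrix_sqrt \<Sigma> *v Z \<omega>) \<partial>N)" .

  \<comment> \<open>At \<open>z = 0\<close> the linear term of \<open>v_fun\<close> vanishes, which
    identifies \<open>K\<close> as \<open>exp (- h_fun)\<close> at \<open>xs\<close> divided by
    \<open>v_fun\<close> at 0.\<close>
  have "exp (- h_fun \<mu> \<Sigma> \<theta> i xs) = K * ?v 0"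
    by (simp add: h_fun_def v_fun_def K_def exp_add[symmetric])
  then have K: "exp (- h_fun \<mu> \<Sigma> \<theta> i xs) * inverse (?v 0) = K"
    by (simp add: v_fun_def)
  \<comment> \<open>This factor cancels the denominator of \<open>L_tilde\<close>. The real
    \<open>sqrt\<close> is odd and vanishes only at 0, so a nonzero determinant suffices.\<close>
  have "sqrt (det (\<Sigma> ** H_mat \<mu> \<Sigma> i xs)) \<noteq> 0"
    using positive_definite_det_pos[OF \<Sigma>] assms(8) by (simp add: det_mul invertible_det_nz)
  then show ?thesis
    unfolding main L_tilde_def K[symmetric] by (simp add: field_simps)
qed

end
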